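(* Let $A_1=P_1-R_1+S_1$ be a convergent double weak splitting of type I of the nonsingular symmetric matrix $A_1\in\mathbb{R}^{n\times n}$ and let $A_2=P_2-R_2+S_2$ be a convergent double weak splitting of type II of the nonsingular symmetric matrix $A_2\in\mathbb{R}^{n\times n}$. Put $$\widehat{\mathbf{W}}_1=\begin{pmatrix}P_1^{-1}R_1 & -P_1^{-1}S_1\\ I & 0\end{pmatrix},\qquad \widetilde{\mathbf{W}}_2=\begin{pmatrix}(R_2P_2^{-1})^T & -(S_2P_2^{-1})^T\\ I & 0\end{pmatrix}.$$ If $(R_2P_2^{-1})^T\le P_1^{-1}R_1$ and $(P_2^{-1})^TA_2\le P_1^{-1}A_1$, then $\rho(\widehat{\mathbf{W}}_1)\le\rho(\widetilde{\mathbf{W}}_2)<1$.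
   Context: Matrix inequalities are entrywise; $\rho$ is the spectral radius; $I$ is the $n\times n$ identity. For a nonsingular $A\in\mathbb{R}^{n\times n}$, a decomposition $A=P-R+S$ with $P$ nonsingular is a double weak splitting of type I if $P^{-1}R\ge 0$ and $-P^{-1}S\ge 0$; it is convergent if $\begin{pmatrix}P^{-1}R & -P^{-1}S\\ I & 0\end{pmatrix}$ has spectral radius less than $1$. For a symmetric nonsingular $A$, such a decomposition is a double weak splitting of type II if $RP^{-1}\ge 0$ and $-SP^{-1}\ge 0$; it is convergent if $\begin{pmatrix}(RP^{-1})^T & -(SP^{-1})^T\\ I & 0\end{pmatrix}$ has spectral radius less than $1$. *)

theory Defs
  imports "Jordan_Normal_Form.Spectral_Radius"
begin

text \<open>The order on \<^typ>\<open>real mat\<close> is the library's entrywise order, which also requires equal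
  dimensions.  \<^const>\<open>mat_inverse\<close> returns an option; the value of \<open>minv A\<close> is meaningful only
  for invertible \<open>A\<close> (see \<open>minv_invertible\<close>).\<close>

definition minv :: "real mat \<Rightarrow> real mat" where
  "minv A = the (mat_inverse A)"

lemma minv_invertible:
  assumes A: "A \<in> carrier_mat n n" and inv: "invertible_mat A"
  shows "minv A \<in> carrier_mat n n" "A * minv A = 1\<^sub>m n" "minv A * A = 1\<^sub>m n"
proof -
  from inv A obtain B where AB: "A * B = 1\<^sub>m n" and BA: "B * A = 1\<^sub>m (dim_row B)"
    unfolding invertible_mat_def inverts_mat_def by auto
  have "dim_col B = n" using arg_cong[OF AB, of dim_col] by simp
  moreover have "dim_row B = n" using arg_cong[OF BA, of dim_col] A by simp
  ultimately have B: "B \<in> carrier_mat n n" by auto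
  have "A \<in> Units (ring_mat TYPE(real) n ())"
    using A B AB BA unfolding Units_def ring_mat_def by auto
  then obtain C where C: "mat_inverse A = Some C"
    using mat_inverse(1)[OF A, where b = "()"] by (cases "mat_inverse A") auto
  from mat_inverse(2)[OF A C]
  show "minv A \<in> carrier_mat n n" "A * minv A = 1\<^sub>m n" "minv A * A = 1\<^sub>m n"
    by (auto simp: minv_def C)
qed

text \<open>Spectral radius over all complex eigenvalues.  It is a maximum, hence unspecified for
  \<open>0 \<times> 0\<close> matrices.\<close>

definition rho :: "real mat \<Rightarrow> real" where
  "rho A = spectral_radius (map_mat complex_of_real A)"

definition symmetric_mat :: "real mat \<Rightarrow> bool" where
  "symmetric_mat A \<longleftrightarrow> transpose_mat A = A"

definition double_decomposition ::
    "nat \<Rightarrow> real mat \<Rightarrow> real mat \<Rightarrow> real mat \<Rightarrow> real mat \<Rightarrow> bool" where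
  "double_decomposition n A P R S \<longleftrightarrow>
     A \<in> carrier_mat n n \<and> P \<in> carrier_mat n n \<and> R \<in> carrier_mat n n \<and> S \<in> carrier_mat n n \<and>
     invertible_mat A \<and> invertible_mat P \<and> A = P - R + S"

definition weak_splitting_I ::
    "nat \<Rightarrow> real mat \<Rightarrow> real mat \<Rightarrow> real mat \<Rightarrow> real mat \<Rightarrow> bool" where
  "weak_splitting_I n A P R S \<longleftrightarrow>
     double_decomposition n A P R S \<and>
     0\<^sub>m n n \<le> minv P * R \<and> 0\<^sub>m n n \<le> - (minv P * S)"

definition weak_splitting_II ::
    "nat \<Rightarrow> real mat \<Rightarrow> real mat \<Rightarrow> real mat \<Rightarrow> real mat \<Rightarrow> bool" where
  "weak_splitting_II n A P R S \<longleftrightarrow>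
     double_decomposition n A P R S \<and> symmetric_mat A \<and>
     0\<^sub>m n n \<le> R * minv P \<and> 0\<^sub>m n n \<le> - (S * minv P)"

definition W_hat :: "nat \<Rightarrow> real mat \<Rightarrow> real mat \<Rightarrow> real mat \<Rightarrow> real mat" where
  "W_hat n P R S = four_block_mat (minv P * R) (- (minv P * S)) (1\<^sub>m n) (0\<^sub>m n n)"

definition W_tilde :: "nat \<Rightarrow> real mat \<Rightarrow> real mat \<Rightarrow> real mat \<Rightarrow> real mat" where
  "W_tilde n P R S =
     four_block_mat (transpose_mat (R * minv P)) (- transpose_mat (S * minv P)) (1\<^sub>m n) (0\<^sub>m n n)"

definition convergent_weak_splitting_I ::
    "nat \<Rightarrow> real mat \<Rightarrow> real mat \<Rightarrow> real mat \<Rightarrow> real mat \<Rightarrow> bool" where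
  "convergent_weak_splitting_I n A P R S \<longleftrightarrow>
     weak_splitting_I n A P R S \<and> rho (W_hat n P R S) < 1"

definition convergent_weak_splitting_II ::
    "nat \<Rightarrow> real mat \<Rightarrow> real mat \<Rightarrow> real mat \<Rightarrow> real mat \<Rightarrow> bool" where
  "convergent_weak_splitting_II n A P R S \<longleftrightarrow>
     weak_splitting_II n A P R S \<and> rho (W_tilde n P R S) < 1"

end

(* The spectral radius of a nonnegative matrix W dominates every l for which W u \<ge> l u has a
   nonzero solution u \<ge> 0: otherwise the powers of W / m, for some m between rho W and l, are
   bounded although they expand u by (l / m)^k.

   Let B, C and B', C' be the upper blocks of the two iteration matrices; the hypotheses say
   B' \<le> B and B + C \<le> B' + C'.  An eigenvector of the first matrix for an eigenvalue k of
   maximal modulus l \<le> 1 is (k y, y) with k^2 y = k B y + C y, so z = |y| satisfies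
     l^2 z \<le> l B z + C z \<le> l B' z + C' z,
   the last step because l (B - B') \<le> B - B' \<le> C' - C.  Thus u = (l z, z) is a test vector
   for the second matrix. *)

theory Submission
  imports Defs
begin

section \<open>Eigenvalues, scaling and powers of real matrices\<close>

lemma mult_mat_vec_index:
  assumes "A \<in> carrier_mat nr nc" "v \<in> carrier_vec nc" "i < nr"
  shows "(A *\<^sub>v v) $ i = (\<Sum>j<nc. A $$ (i,j) * v $ j)"
  using assms by (simp add: scalar_prod_def atLeast0LessThan)

lemma rho_eigenvalue_norm_le:
  assumes A: "A \<in> carrier_mat n n" and ev: "eigenvalue (map_mat complex_of_real A) k"
  shows "cmod k \<le> rho A"
proof -
  have Ac: "map_mat complex_of_real A \<in> carrier_mat n n" using A by simp
  \<comment> \<open>An eigenvalue exists only in positive dimension, so the maximum that defines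
    \<open>rho\<close> is over a nonempty set.\<close>
  have "n > 0" using eigenvalue_imp_nonzero_dim[OF Ac ev] .
  then show ?thesis
    unfolding rho_def using spectral_radius_mem_max(2)[OF Ac] ev by (auto simp: spectrum_def)
qed

lemma rho_eigenvalueE:
  assumes A: "A \<in> carrier_mat n n" and n: "n > 0"
  obtains k where "eigenvalue (map_mat complex_of_real A) k" "cmod k = rho A"
proof -
  have Ac: "map_mat complex_of_real A \<in> carrier_mat n n" using A by simp
  from spectral_radius_mem_max(1)[OF Ac n] that show ?thesis
    by (auto simp: spectrum_def rho_def)
qed

text \<open>The Jordan normal form bounds the powers of a complex matrix with spectral radius below
  1, uniformly in the exponent. The embedding of the reals commutes with powers and preserves
  absolute values, so the bound passes to the real entries.\<close>

lemma bounded_powers: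
  fixes A :: "real mat"
  assumes A: "A \<in> carrier_mat n n" and "rho A < 1"
  obtains c where "\<And>k i j. i < n \<Longrightarrow> j < n \<Longrightarrow> \<bar>(A ^\<^sub>m k) $$ (i,j)\<bar> \<le> c"
proof -
  have "\<exists>c. \<forall>k. norm_bound (map_mat complex_of_real A ^\<^sub>m k) c"
    using assms spectral_radius_jnf_norm_bound_less_1_upper_triangular[of "map_mat of_real A" n]
    by (simp add: rho_def)
  then obtain c where c: "\<And>k. norm_bound (map_mat complex_of_real A ^\<^sub>m k) c" by blast
  have "\<bar>(A ^\<^sub>m k) $$ (i,j)\<bar> \<le> c" if "i < n" "j < n" for k i j
  proof -
    have "norm_bound (map_mat complex_of_real (A ^\<^sub>m k)) c"
      using c[of k] of_real_hom.mat_hom_pow[OF A, of k] by metis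
    then show ?thesis using that A by (auto simp: norm_bound_def)
  qed
  then show thesis by (rule that)
qed

text \<open>An eigenvector of \<open>c A\<close> for \<open>k\<close> is an eigenvector of
  \<open>A\<close> for \<open>k / c\<close>. Applied with \<open>c = 1 / m\<close> to bring the
  spectral radius below 1.\<close>

lemma rho_smult_le:
  assumes A: "A \<in> carrier_mat n n" and n: "n > 0" and c: "c > 0"
  shows "rho (c \<cdot>\<^sub>m A) \<le> c * rho A"
proof -
  have cA: "c \<cdot>\<^sub>m A \<in> carrier_mat n n" using A by simp
  obtain k where k: "eigenvalue (map_mat complex_of_real (c \<cdot>\<^sub>m A)) k"
    and eq: "cmod k = rho (c \<cdot>\<^sub>m A)"
    using rho_eigenvalueE[OF cA n] .
  from k obtain v where v: "v \<in> carrier_vec n" "v \<noteq> 0\<^sub>v n"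
    and Av: "map_mat complex_of_real (c \<cdot>\<^sub>m A) *\<^sub>v v = k \<cdot>\<^sub>v v"
    using A unfolding eigenvalue_def eigenvector_def by auto
  have "map_mat complex_of_real A *\<^sub>v v = (k / c) \<cdot>\<^sub>v v"
  proof (rule eq_vecI)
    fix i assume "i < dim_vec ((k / c) \<cdot>\<^sub>v v)"
    then have i: "i < n" using v by simp
    have "complex_of_real c * (map_mat complex_of_real A *\<^sub>v v) $ i
        = (map_mat complex_of_real (c \<cdot>\<^sub>m A) *\<^sub>v v) $ i"
      using A v i by (simp add: mult_mat_vec_index[where nr = n and nc = n] sum_distrib_left mult.assoc
          del: index_mult_mat_vec)
    also have "\<dots> = k * v $ i" unfolding Av using v i by simp
    finally show "(map_mat complex_of_real A *\<^sub>v v) $ i = ((k / c) \<cdot>\<^sub>v v) $ i"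
      using c v i by (simp add: field_simps del: index_mult_mat_vec)
  qed (use A v in auto)
  then have "eigenvalue (map_mat complex_of_real A) (k / c)"
    using A v unfolding eigenvalue_def eigenvector_def by auto
  from rho_eigenvalue_norm_le[OF A this] show ?thesis
    using eq c by (simp add: norm_divide field_simps)
qed

section \<open>Lower bounds for the spectral radius of a nonnegative matrix\<close>

text \<open>One step of the induction is B^(k+1) u = B^k (B u) \<ge> t B^k u \<ge> t^(k+1) u. The
  first inequality needs row \<open>i\<close> of B^k to be nonnegative, so that property is carried
  through the same induction; the second needs \<open>t \<ge> 0\<close>.\<close>

lemma pow_mult_vec_ge:
  fixes B :: "real mat"
  assumes B: "B \<in> carrier_mat n n" and u: "u \<in> carrier_vec n" and t: "t \<ge> 0"
    and nonneg: "\<And>i j. i < n \<Longrightarrow> j < n \<Longrightarrow> B $$ (i,j) \<ge> 0"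
    and sub: "\<And>i. i < n \<Longrightarrow> t * u $ i \<le> (B *\<^sub>v u) $ i"
    and i: "i < n"
  shows "(\<forall>j<n. (B ^\<^sub>m k) $$ (i,j) \<ge> 0) \<and> t ^ k * u $ i \<le> (B ^\<^sub>m k *\<^sub>v u) $ i"
proof (induction k)
  case 0
  then show ?case using B u i by simp
next
  case (Suc k)
  have Bk: "B ^\<^sub>m k \<in> carrier_mat n n" using B by simp
  have Bu: "B *\<^sub>v u \<in> carrier_vec n" using B u by (rule mult_mat_vec_carrier)
  have "(B ^\<^sub>m k * B) $$ (i,j) \<ge> 0" if "j < n" for j
    using that i Bk B Suc.IH nonneg by (auto simp: scalar_prod_def intro!: sum_nonneg)
  moreover have "t ^ Suc k * u $ i \<le> (B ^\<^sub>m Suc k *\<^sub>v u) $ i"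
  proof -
    have "t ^ Suc k * u $ i \<le> t * (B ^\<^sub>m k *\<^sub>v u) $ i"
      using Suc.IH t by (simp add: mult_left_mono mult.assoc del: index_mult_mat_vec)
    also have "\<dots> = (\<Sum>j<n. (B ^\<^sub>m k) $$ (i,j) * (t * u $ j))"
      unfolding mult_mat_vec_index[OF Bk u i] by (simp add: sum_distrib_left mult_ac)
    also have "\<dots> \<le> (\<Sum>j<n. (B ^\<^sub>m k) $$ (i,j) * (B *\<^sub>v u) $ j)"
      using Suc.IH sub by (intro sum_mono mult_left_mono) auto
    also have "\<dots> = (B ^\<^sub>m Suc k *\<^sub>v u) $ i"
      using mult_mat_vec_index[OF Bk Bu i] assoc_mult_mat_vec[OF Bk B u] by simp
    finally show ?thesis .
  qed
  ultimately show ?case by simp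
qed

text \<open>The lower Collatz-Wielandt bound. The sign of \<open>l\<close> is left open: a
  counterexample would satisfy \<open>l > rho A \<ge> 0\<close> and so be positive.\<close>

lemma subinvariant_le_rho:
  fixes A :: "real mat"
  assumes A: "A \<in> carrier_mat n n"
    and nonneg: "\<And>i j. i < n \<Longrightarrow> j < n \<Longrightarrow> A $$ (i,j) \<ge> 0"
    and u: "u \<in> carrier_vec n" "u \<noteq> 0\<^sub>v n" and u0: "\<And>i. i < n \<Longrightarrow> u $ i \<ge> 0"
    and sub: "\<And>i. i < n \<Longrightarrow> l * u $ i \<le> (A *\<^sub>v u) $ i"
  shows "l \<le> rho A"
proof (rule ccontr)
  assume "\<not> l \<le> rho A"
  then obtain m where m: "rho A < m" "m < l" using dense by (meson not_le)
  \<comment> \<open>The growth is observed in this single coordinate. Its existence also gives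
    \<open>n > 0\<close>, so that \<open>rho A\<close> is the modulus of an eigenvalue and therefore
    nonnegative.\<close>
  from u obtain i where i: "i < n" "u $ i \<noteq> 0" by (auto simp: vec_eq_iff)
  then have ui: "u $ i > 0" using u0[OF i(1)] by simp
  have n: "n > 0" using i by simp
  have "rho A \<ge> 0" using rho_eigenvalueE[OF A n] norm_ge_zero by metis
  then have m0: "m > 0" using m by simp
  define B where "B = (1 / m) \<cdot>\<^sub>m A"
  have B: "B \<in> carrier_mat n n" using A by (simp add: B_def)
  have "rho B \<le> (1 / m) * rho A" unfolding B_def using m0 by (intro rho_smult_le[OF A n]) simp
  also have "\<dots> < 1" using m m0 by (simp add: field_simps)
  finally obtain c where c: "\<And>k i j. i < n \<Longrightarrow> j < n \<Longrightarrow> \<bar>(B ^\<^sub>m k) $$ (i,j)\<bar> \<le> c"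
    using bounded_powers[OF B] by blast
  have lm: "l / m > 1" using m m0 by simp
  have B0: "B $$ (i,j) \<ge> 0" if "i < n" "j < n" for i j
    using that A nonneg[OF that] m0 by (simp add: B_def)
  have subB: "l / m * u $ i \<le> (B *\<^sub>v u) $ i" if "i < n" for i
  proof -
    have "(B *\<^sub>v u) $ i = (A *\<^sub>v u) $ i / m"
      using A u that by (simp add: B_def)
    then show ?thesis using sub[OF that] m0 by (simp add: divide_right_mono del: index_mult_mat_vec)
  qed
  \<comment> \<open>Entry \<open>i\<close> of B^k u is at most c times the sum of the entries of
    \<open>u\<close>, whatever the exponent; this \<open>k\<close> lifts (l/m)^k u_i above that
    bound.\<close>
  obtain k where k: "c * (\<Sum>j<n. u $ j) / u $ i < (l / m) ^ k"
    using real_arch_pow[OF lm] by blast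
  have "(l / m) ^ k * u $ i \<le> (B ^\<^sub>m k *\<^sub>v u) $ i"
    using pow_mult_vec_ge[OF B u(1) _ B0 subB i(1), of k] lm by simp
  also have "\<dots> = (\<Sum>j<n. (B ^\<^sub>m k) $$ (i,j) * u $ j)"
    using mult_mat_vec_index[OF pow_carrier_mat[OF B] u(1) i(1)] .
  also have "\<dots> \<le> (\<Sum>j<n. c * u $ j)"
    using c[OF i(1)] u0 by (intro sum_mono mult_right_mono) (auto intro: order_trans[OF abs_ge_self])
  finally show False using k ui by (simp add: sum_distrib_left field_simps)
qed

section \<open>Block companion matrices\<close>

text \<open>The linearization of the quadratic eigenvalue problem k^2 y = k B y + C y. Both
  iteration matrices have this shape. The entry type is left general because eigenvectors live over
  the complex numbers and test vectors over the reals.\<close>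

abbreviation companion :: "'a :: comm_ring_1 mat \<Rightarrow> 'a mat \<Rightarrow> 'a mat" where
  "companion B C \<equiv>
     four_block_mat B C (1\<^sub>m (dim_row B)) (0\<^sub>m (dim_row B) (dim_row B))"

lemma companion_mult_vec:
  assumes "B \<in> carrier_mat n n" "C \<in> carrier_mat n n" "x \<in> carrier_vec n" "y \<in> carrier_vec n"
  shows "companion B C *\<^sub>v (x @\<^sub>v y) = (B *\<^sub>v x + C *\<^sub>v y) @\<^sub>v x"
proof -
  have "0\<^sub>m n n *\<^sub>v y = 0\<^sub>v n" using assms by (intro eq_vecI) auto
  then show ?thesis
    using assms four_block_mat_mult_vec[of B n n C n "1\<^sub>m n" n "0\<^sub>m n n" x y] by simp
qed

lemma map_mat_companion:
  assumes "B \<in> carrier_mat n n" "C \<in> carrier_mat n n"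
  shows "map_mat complex_of_real (companion B C)
    = companion (map_mat complex_of_real B) (map_mat complex_of_real C)"
  using assms by (intro eq_matI) auto

text \<open>The lower block row forces the upper half of an eigenvector to be \<open>k\<close> times
  the lower half \<open>y\<close>. Hence \<open>y = 0\<close> would annihilate the whole
  eigenvector.\<close>

lemma companion_eigenvectorE:
  fixes B C :: "'a :: comm_ring_1 mat"
  assumes B: "B \<in> carrier_mat n n" and C: "C \<in> carrier_mat n n"
    and ev: "eigenvalue (companion B C) k"
  obtains y where "y \<in> carrier_vec n" "y \<noteq> 0\<^sub>v n"
    "B *\<^sub>v (k \<cdot>\<^sub>v y) + C *\<^sub>v y = k \<cdot>\<^sub>v (k \<cdot>\<^sub>v y)"
proof -
  from ev obtain v where v: "v \<in> carrier_vec (n + n)" "v \<noteq> 0\<^sub>v (n + n)"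
    and Wv: "companion B C *\<^sub>v v = k \<cdot>\<^sub>v v"
    using B C unfolding eigenvalue_def eigenvector_def by auto
  define x where "x = vec_first v n"
  define y where "y = vec_last v n"
  have x: "x \<in> carrier_vec n" and y: "y \<in> carrier_vec n" by (simp_all add: x_def y_def)
  have vxy: "v = x @\<^sub>v y" using v by (simp add: x_def y_def)
  have "(B *\<^sub>v x + C *\<^sub>v y) @\<^sub>v x = k \<cdot>\<^sub>v x @\<^sub>v k \<cdot>\<^sub>v y"
  proof -
    have "k \<cdot>\<^sub>v (x @\<^sub>v y) = k \<cdot>\<^sub>v x @\<^sub>v k \<cdot>\<^sub>v y"
      by (intro eq_vecI) auto
    then show ?thesis using Wv unfolding vxy companion_mult_vec[OF B C x y] by simp
  qed
  then have top: "B *\<^sub>v x + C *\<^sub>v y = k \<cdot>\<^sub>v x" and bot: "x = k \<cdot>\<^sub>v y"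
    using B C x y append_vec_eq[of "B *\<^sub>v x + C *\<^sub>v y" n "k \<cdot>\<^sub>v x"] by auto
  have "y \<noteq> 0\<^sub>v n"
  proof
    assume "y = 0\<^sub>v n"
    moreover have "k \<cdot>\<^sub>v 0\<^sub>v n = 0\<^sub>v n" by (intro eq_vecI) auto
    ultimately have "v = 0\<^sub>v n @\<^sub>v 0\<^sub>v n" using bot by (simp add: vxy)
    also have "\<dots> = 0\<^sub>v (n + n)" by (intro eq_vecI) auto
    finally show False using v by simp
  qed
  then show thesis using that[OF y] top bot by simp
qed

text \<open>With weight \<open>l \<le> 1\<close> on the first block, moving mass from the first
  block to the second, and possibly adding some, cannot decrease \<open>l B + C\<close>. This is
  where the bound \<open>rho_le\<close> enters.\<close>

lemma rho_companion_le:
  fixes B C B' C' :: "real mat"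
  assumes n: "n > 0"
    and car: "B \<in> carrier_mat n n" "C \<in> carrier_mat n n" "B' \<in> carrier_mat n n" "C' \<in> carrier_mat n n"
    and B: "0\<^sub>m n n \<le> B" and C: "0\<^sub>m n n \<le> C" and B': "0\<^sub>m n n \<le> B'" and C': "0\<^sub>m n n \<le> C'"
    and le: "B' \<le> B" and sum_le: "B + C \<le> B' + C'"
    and rho_le: "rho (companion B C) \<le> 1"
  shows "rho (companion B C) \<le> rho (companion B' C')"
proof -
  let ?l = "rho (companion B C)"
  let ?c = "map_mat complex_of_real"
  have W: "companion B C \<in> carrier_mat (n + n) (n + n)"
    and W': "companion B' C' \<in> carrier_mat (n + n) (n + n)" using car by auto
  obtain k where ev: "eigenvalue (?c (companion B C)) k" and k: "cmod k = ?l"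
    using rho_eigenvalueE[OF W] n by auto
  have cc: "?c B \<in> carrier_mat n n" "?c C \<in> carrier_mat n n" using car by auto
  obtain y where y: "y \<in> carrier_vec n" "y \<noteq> 0\<^sub>v n"
    and eq: "?c B *\<^sub>v (k \<cdot>\<^sub>v y) + ?c C *\<^sub>v y = k \<cdot>\<^sub>v (k \<cdot>\<^sub>v y)"
    using companion_eigenvectorE[OF cc ev[unfolded map_mat_companion[OF car(1,2)]]] .
  define z where "z = map_vec cmod y"
  have z: "z \<in> carrier_vec n" and z_nz: "z \<noteq> 0\<^sub>v n" and z0: "\<And>i. i < n \<Longrightarrow> z $ i \<ge> 0"
    using y by (auto simp: z_def vec_eq_iff)
  have l0: "?l \<ge> 0" using k norm_ge_zero[of k] by linarith
  have lz: "?l \<cdot>\<^sub>v z \<in> carrier_vec n" using z by simp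
  have main: "?l * (?l * z $ i) \<le> (B' *\<^sub>v (?l \<cdot>\<^sub>v z) + C' *\<^sub>v z) $ i" if i: "i < n" for i
  proof -
    have "k * (k * y $ i) = (?c B *\<^sub>v (k \<cdot>\<^sub>v y) + ?c C *\<^sub>v y) $ i"
      unfolding eq using i y by simp
    also have "\<dots> = (\<Sum>j<n. B $$ (i,j) * (k * y $ j)) + (\<Sum>j<n. C $$ (i,j) * y $ j)"
      using i y car cc by (simp add: mult_mat_vec_index[OF cc(1)] mult_mat_vec_index[OF cc(2)]
          del: index_mult_mat_vec)
    also have "\<dots> = (\<Sum>j<n. B $$ (i,j) * (k * y $ j) + C $$ (i,j) * y $ j)"
      by (simp add: sum.distrib)
    finally have row: "k * (k * y $ i) = \<dots>" .
    have "?l * (?l * z $ i) = cmod (k * (k * y $ i))"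
      using i y by (simp add: norm_mult k z_def)
    also have "\<dots> = cmod (\<Sum>j<n. B $$ (i,j) * (k * y $ j) + C $$ (i,j) * y $ j)"
      unfolding row ..
    also have "\<dots> \<le> (\<Sum>j<n. (?l * B $$ (i,j) + C $$ (i,j)) * z $ j)"
    proof (intro sum_norm_le)
      fix j assume "j \<in> {..<n}"
      then have j: "j < n" by simp
      \<comment> \<open>By nonnegativity each coefficient is its own modulus, so the triangle
        inequality gives exactly the coefficient \<open>?l B + C\<close> of
        \<open>z\<close>.\<close>
      have Bij: "B $$ (i,j) \<ge> 0" and Cij: "C $$ (i,j) \<ge> 0"
        using B C i j car by (auto simp: less_eq_mat_def)
      show "cmod (B $$ (i,j) * (k * y $ j) + C $$ (i,j) * y $ j) \<le> (?l * B $$ (i,j) + C $$ (i,j)) * z $ j"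
        using norm_triangle_ineq[of "B $$ (i,j) * (k * y $ j)" "C $$ (i,j) * y $ j"] j y Bij Cij
        by (simp add: norm_mult k z_def algebra_simps)
    qed
    also have "\<dots> \<le> (\<Sum>j<n. (?l * B' $$ (i,j) + C' $$ (i,j)) * z $ j)"
    proof (intro sum_mono mult_right_mono)
      fix j assume "j \<in> {..<n}"
      then have j: "j < n" by simp
      have BB: "B' $$ (i,j) \<le> B $$ (i,j)" using le i j car by (auto simp: less_eq_mat_def)
      have "B $$ (i,j) + C $$ (i,j) \<le> B' $$ (i,j) + C' $$ (i,j)"
        using sum_le i j car by (auto simp: less_eq_mat_def)
      moreover have "?l * (B $$ (i,j) - B' $$ (i,j)) \<le> B $$ (i,j) - B' $$ (i,j)"
        using mult_right_mono[OF rho_le, of "B $$ (i,j) - B' $$ (i,j)"] BB by simp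
      ultimately show "?l * B $$ (i,j) + C $$ (i,j) \<le> ?l * B' $$ (i,j) + C' $$ (i,j)"
        by (simp add: algebra_simps)
      show "0 \<le> z $ j" using z0 j .
    qed
    also have "\<dots> = (\<Sum>j<n. B' $$ (i,j) * (?l * z $ j)) + (\<Sum>j<n. C' $$ (i,j) * z $ j)"
      unfolding sum.distrib[symmetric] by (intro sum.cong refl) (simp add: algebra_simps)
    also have "\<dots> = (B' *\<^sub>v (?l \<cdot>\<^sub>v z) + C' *\<^sub>v z) $ i"
      using i car z mult_mat_vec_index[OF car(3) lz i] mult_mat_vec_index[OF car(4) z i]
      by (simp del: index_mult_mat_vec)
    finally show ?thesis .
  qed
  define u where "u = ?l \<cdot>\<^sub>v z @\<^sub>v z"
  have W'u: "companion B' C' *\<^sub>v u = (B' *\<^sub>v (?l \<cdot>\<^sub>v z) + C' *\<^sub>v z) @\<^sub>v ?l \<cdot>\<^sub>v z"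
    unfolding u_def by (rule companion_mult_vec[OF car(3,4) lz z])
  show ?thesis
  proof (rule subinvariant_le_rho[OF W'])
    show "companion B' C' $$ (i,j) \<ge> 0" if "i < n + n" "j < n + n" for i j
    proof -
      have "B' $$ (p,q) \<ge> 0" "C' $$ (p,q) \<ge> 0" if "p < n" "q < n" for p q
        using B' C' car that by (auto simp: less_eq_mat_def)
      then show ?thesis using that car by simp
    qed
    show "u \<in> carrier_vec (n + n)" using z lz by (simp add: u_def)
    \<comment> \<open>The nonzero entry is taken from the lower half, since the upper half vanishes
      when \<open>?l = 0\<close>.\<close>
    from z_nz z obtain i where i: "i < n" "z $ i \<noteq> 0" by (auto simp: vec_eq_iff)
    then have "u $ (n + i) \<noteq> 0" using z by (simp add: u_def)
    then show "u \<noteq> 0\<^sub>v (n + n)" using i by auto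
    show "u $ i \<ge> 0" if "i < n + n" for i
      using that z z0 l0 by (auto simp: u_def)
    \<comment> \<open>The upper half is \<open>main\<close>; in the lower half both sides are
      entries of \<open>?l\<close> times \<open>z\<close>.\<close>
    show "?l * u $ i \<le> (companion B' C' *\<^sub>v u) $ i" if "i < n + n" for i
      unfolding W'u using that main[of i] z car by (cases "i < n") (auto simp: u_def simp del: index_mult_mat_vec)
  qed
qed

section \<open>From double splittings to companion matrices\<close>

lemma minv_mult_decomposition:
  assumes "double_decomposition n A P R S"
  shows "minv P * A = 1\<^sub>m n - minv P * R + minv P * S"
proof -
  from assms have car: "P \<in> carrier_mat n n" "R \<in> carrier_mat n n" "S \<in> carrier_mat n n"
    and inv: "invertible_mat P" and A: "A = P - R + S"
    by (auto simp: double_decomposition_def)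
  note Q = minv_invertible[OF car(1) inv]
  have PR: "P - R \<in> carrier_mat n n" using car by auto
  show ?thesis
    using mult_add_distrib_mat[OF Q(1) PR car(3)]
      mult_minus_distrib_mat[OF Q(1) car(1,2)] car Q by (simp add: A)
qed

text \<open>Multiplication from the right fits type II, whose sign conditions concern
  \<open>R * minv P\<close> and \<open>S * minv P\<close>.\<close>

lemma decomposition_mult_minv:
  assumes "double_decomposition n A P R S"
  shows "A * minv P = 1\<^sub>m n - R * minv P + S * minv P"
proof -
  from assms have car: "P \<in> carrier_mat n n" "R \<in> carrier_mat n n" "S \<in> carrier_mat n n"
    and inv: "invertible_mat P" and A: "A = P - R + S"
    by (auto simp: double_decomposition_def)
  note Q = minv_invertible[OF car(1) inv]
  have PR: "P - R \<in> carrier_mat n n" using car by auto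
  show ?thesis
    using add_mult_distrib_mat[OF PR car(3) Q(1)]
      minus_mult_distrib_mat[OF car(1,2) Q(1)] car Q by (simp add: A)
qed

theorem theorem3p18:
  fixes n :: nat and A\<^sub>1 P\<^sub>1 R\<^sub>1 S\<^sub>1 A\<^sub>2 P\<^sub>2 R\<^sub>2 S\<^sub>2 :: "real mat"
  assumes "n \<ge> 1"
    and "symmetric_mat A\<^sub>1"
    and "symmetric_mat A\<^sub>2"
    and "convergent_weak_splitting_I n A\<^sub>1 P\<^sub>1 R\<^sub>1 S\<^sub>1"
    and "convergent_weak_splitting_II n A\<^sub>2 P\<^sub>2 R\<^sub>2 S\<^sub>2"
    and "transpose_mat (R\<^sub>2 * minv P\<^sub>2) \<le> minv P\<^sub>1 * R\<^sub>1"
    and "transpose_mat (minv P\<^sub>2) * A\<^sub>2 \<le> minv P\<^sub>1 * A\<^sub>1"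
  shows "rho (W_hat n P\<^sub>1 R\<^sub>1 S\<^sub>1) \<le> rho (W_tilde n P\<^sub>2 R\<^sub>2 S\<^sub>2)
    \<and> rho (W_tilde n P\<^sub>2 R\<^sub>2 S\<^sub>2) < 1"
proof -
  from assms(4) have dd1: "double_decomposition n A\<^sub>1 P\<^sub>1 R\<^sub>1 S\<^sub>1"
    and B0: "0\<^sub>m n n \<le> minv P\<^sub>1 * R\<^sub>1" and C0: "0\<^sub>m n n \<le> - (minv P\<^sub>1 * S\<^sub>1)"
    and rho1: "rho (W_hat n P\<^sub>1 R\<^sub>1 S\<^sub>1) < 1"
    by (auto simp: convergent_weak_splitting_I_def weak_splitting_I_def)
  from assms(5) have dd2: "double_decomposition n A\<^sub>2 P\<^sub>2 R\<^sub>2 S\<^sub>2"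
    and B'0: "0\<^sub>m n n \<le> R\<^sub>2 * minv P\<^sub>2" and C'0: "0\<^sub>m n n \<le> - (S\<^sub>2 * minv P\<^sub>2)"
    and rho2: "rho (W_tilde n P\<^sub>2 R\<^sub>2 S\<^sub>2) < 1"
    by (auto simp: convergent_weak_splitting_II_def weak_splitting_II_def)
  \<comment> \<open>\<open>C\<close> and \<open>C'\<close> absorb the minus signs, which makes all
    four blocks nonnegative.\<close>
  define B C where "B = minv P\<^sub>1 * R\<^sub>1" and "C = - (minv P\<^sub>1 * S\<^sub>1)"
  define B' C' where "B' = transpose_mat (R\<^sub>2 * minv P\<^sub>2)" and "C' = - transpose_mat (S\<^sub>2 * minv P\<^sub>2)"
  have car: "minv P\<^sub>1 * R\<^sub>1 \<in> carrier_mat n n" "minv P\<^sub>1 * S\<^sub>1 \<in> carrier_mat n n"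
    "R\<^sub>2 * minv P\<^sub>2 \<in> carrier_mat n n" "S\<^sub>2 * minv P\<^sub>2 \<in> carrier_mat n n"
    "A\<^sub>2 \<in> carrier_mat n n" "minv P\<^sub>2 \<in> carrier_mat n n"
    using dd1 dd2 minv_invertible(1) by (auto simp: double_decomposition_def intro!: mult_carrier_mat)
  have cars: "B \<in> carrier_mat n n" "C \<in> carrier_mat n n" "B' \<in> carrier_mat n n" "C' \<in> carrier_mat n n"
    using car by (auto simp: B_def C_def B'_def C'_def)
  have eq1: "minv P\<^sub>1 * A\<^sub>1 = 1\<^sub>m n - B - C"
    unfolding minv_mult_decomposition[OF dd1] B_def C_def using car by (intro eq_matI) auto
  \<comment> \<open>Symmetry of \<open>A\<^sub>2\<close> turns this product into a transpose, and
    the type II decomposition then yields the blocks \<open>B'\<close> and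
    \<open>C'\<close>.\<close>
  have "transpose_mat (minv P\<^sub>2) * A\<^sub>2 = transpose_mat (A\<^sub>2 * minv P\<^sub>2)"
    using transpose_mult[OF car(5,6)] assms(3) by (simp add: symmetric_mat_def)
  also have "\<dots> = 1\<^sub>m n - B' - C'"
  proof -
    have "transpose_mat (1\<^sub>m n - X + Y) = 1\<^sub>m n - transpose_mat X - (- transpose_mat Y)"
      if "X \<in> carrier_mat n n" "Y \<in> carrier_mat n n" for X Y :: "real mat"
      using that by (intro eq_matI) auto
    from this[OF car(3,4)] show ?thesis
      unfolding decomposition_mult_minv[OF dd2] B'_def C'_def .
  qed
  finally have le: "1\<^sub>m n - B' - C' \<le> 1\<^sub>m n - B - C"
    using assms(7) eq1 by simp
  \<comment> \<open>Cancelling the identity reverses the inequality between the preconditioned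
    matrices.\<close>
  have sum_le: "B + C \<le> B' + C'"
    unfolding less_eq_mat_def
  proof (intro conjI allI impI)
    fix i j assume "i < dim_row (B' + C')" "j < dim_col (B' + C')"
    then have ij: "i < n" "j < n" using cars by auto
    then have "(1\<^sub>m n - B' - C') $$ (i,j) \<le> (1\<^sub>m n - B - C) $$ (i,j)"
      using le cars by (simp add: less_eq_mat_def)
    then show "(B + C) $$ (i,j) \<le> (B' + C') $$ (i,j)"
      using ij cars by simp
  qed (use cars in auto)
  have W1: "W_hat n P\<^sub>1 R\<^sub>1 S\<^sub>1 = companion B C" and W2: "W_tilde n P\<^sub>2 R\<^sub>2 S\<^sub>2 = companion B' C'"
    using cars by (auto simp: W_hat_def W_tilde_def B_def C_def B'_def C'_def)
  have nonneg: "0\<^sub>m n n \<le> B" "0\<^sub>m n n \<le> C" "0\<^sub>m n n \<le> B'" "0\<^sub>m n n \<le> C'"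
    using B0 C0 B'0 C'0 car by (auto simp: B_def C_def B'_def C'_def less_eq_mat_def)
  have "B' \<le> B" using assms(6) by (simp add: B_def B'_def)
  \<comment> \<open>Convergence of the first splitting supplies the bound by 1 on the smaller
    spectral radius.\<close>
  then have "rho (companion B C) \<le> rho (companion B' C')"
    using rho_companion_le[OF _ cars nonneg _ sum_le] assms(1) rho1 W1 by simp
  then show ?thesis using rho2 W1 W2 by simp
qed

end
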